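(* If $K\subset\mathbb R^n$ is a convex body containing the origin in its interior, then \[ \xi_{K^\circ}(K)\ \ge\ 2+\frac{2}{n}, \] and the bound is sharp (for every $n\ge 1$ there exists such a convex body $K\subset\mathbb R^n$ for which equality holds).
   Context: A convex body is a compact convex set with non-empty interior; neither smoothness nor central symmetry is assumed. Write $V=\mathbb R^n$. The polar of $K$ is $K^\circ=\{p\in V^*:\langle p,x\rangle\le1\ \forall x\in K\}\subset V^*$. For a convex body $T\subset V^*$ with the origin in its interior, $\|v\|_T=\max_{p\in T}\langle p,v\rangle$ for $v\in V$ (a possibly asymmetric norm on $V$ whose unit ball is the polar of $T$). In particular $\|\cdot\|_{K^\circ}$ is the possibly asymmetric norm with unit ball $K$, i.e. $\|w\|_{K^\circ}=\min\{s\ge0: w\in sK\}$. For $q_1,\dots,q_m\in V$ put $\ell_T(q_1,\dots,q_m)=\sum_{i=1}^m\|q_{i+1}-q_i\|_T$ with indices modulo $m$. $\mathcal P_m(K)$ is the set of all $(q_1,\dots,q_m)\in V^m$ such that $\{q_1,\dots,q_m\}$ does not fit into $\alpha K+t$ for any $\alpha\in(0,1)$, $t\in V$ (equivalently, is not contained in the interior of any translate of $K$). For arbitrary (not necessarily smooth) $K$ and $T$, the quantity $\xi_T(K)$ is defined by \[ \xi_T(K)=\min_{m\ge1}\ \min_{P\in\mathcal P_m(K)}\ell_T(P) \] (a minimum over an empty set is $+\infty$); for smooth $K$ and $T$ it is the minimal $\|\cdot\|_T$-length of a closed billiard trajectory in $K$. *)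

theory Defs
  imports "HOL-Analysis.Analysis"
begin

definition convex_body :: "'a::euclidean_space set \<Rightarrow> bool" where
  "convex_body K \<longleftrightarrow> compact K \<and> convex K \<and> interior K \<noteq> {}"

text \<open>
  The dual space of \<open>V\<close> is the type \<open>('v, real) blinfun\<close> of bounded linear functionals; on a
  Euclidean space every linear functional is bounded.
\<close>

definition polar_body :: "'v::euclidean_space set \<Rightarrow> ('v, real) blinfun set" where
  "polar_body K = {p. \<forall>x\<in>K. blinfun_apply p x \<le> 1}"

text \<open>
  For compact nonempty \<open>T\<close> the supremum is a maximum. No symmetry is assumed, so in general
  \<open>asym_norm T (- v) \<noteq> asym_norm T v\<close>.
\<close>

definition asym_norm :: "('v::euclidean_space, real) blinfun set \<Rightarrow> 'v \<Rightarrow> real" where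
  "asym_norm T v = (SUP p\<in>T. blinfun_apply p v)"

text \<open>A tuple \<open>(q\<^sub>1, \<dots>, q\<^sub>m)\<close> is a list of length \<open>m\<close>, indexed from 0.\<close>

definition closed_length :: "('v::euclidean_space, real) blinfun set \<Rightarrow> 'v list \<Rightarrow> real" where
  "closed_length T qs =
     (\<Sum>i<length qs. asym_norm T (qs ! (Suc i mod length qs) - qs ! i))"

definition nonfitting_tuples :: "nat \<Rightarrow> 'v::euclidean_space set \<Rightarrow> 'v list set" where
  "nonfitting_tuples m K =
     {qs. length qs = m \<and>
          \<not> (\<exists>\<alpha> t. 0 < \<alpha> \<and> \<alpha> < 1 \<and> set qs \<subseteq> (\<lambda>x. \<alpha> *\<^sub>R x + t) ` K)}"

text \<open>
  The minima of the definition are taken as infima in the extended reals: they agree whenever the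
  minimum exists, and the infimum of the empty set is \<open>\<infinity>\<close>.
\<close>

definition xi :: "('v::euclidean_space, real) blinfun set \<Rightarrow> 'v set \<Rightarrow> ereal" where
  "xi T K = (INF m\<in>{1..}. INF qs\<in>nonfitting_tuples m K. ereal (closed_length T qs))"

end

theory Submission
  imports Defs
begin

text \<open>
  The lower bound: let a closed polygon have length \<open>L < 2 + 2/n\<close>. To see that its vertices fit
  into a smaller homothet of \<open>K\<close>, a common translation vector is needed, and by Helly's theorem it
  is enough to find one for every \<open>k + 1 \<le> n + 1\<close> of the vertices. The distance from one vertex to
  another, measured by \<open>K\<close>, is at most the length of the path between them along the polygon, in
  the direction of travel; for a pair of distinct vertices the paths there and back add up to \<open>L\<close>.
  A convex combination of the \<open>k + 1\<close> vertices, each weighted by the fraction of \<open>L\<close> that lies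
  between its predecessor and itself, is then a suitable centre: with these weights the average
  path length \<open>F\<close> to a vertex does not depend on the vertex (moving on by one edge adds the edge
  length to all paths but one, and shortens that one by the rest of the circuit). Averaging once
  more shows \<open>2 F = L (1 - \<Sum> w\<^sub>i\<^sup>2) \<le> L k / (k + 1)\<close>, so that
  \<open>F \<le> L n / (2 (n + 1)) < 1\<close> (\<open>circular_weights\<close>, \<open>cycle_center\<close>, \<open>short_polygon_fits\<close>).
  Everything is expressed through the functionals in the polar of \<open>K\<close>; only at the end is
  membership in \<open>K\<close> recovered from them by separation (\<open>bipolar\<close>).

  Sharpness: let \<open>K\<close> be a simplex with vertices \<open>v\<^sub>0, \<dots>, v\<^sub>n\<close> and centroid 0, and let the
  polygon have the edges \<open>(2/n) v\<^sub>j\<close>. Each of the \<open>n + 1\<close> edges has length at most \<open>2/n\<close>. The facet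
  functionals \<open>\<phi>\<^sub>0, \<dots>, \<phi>\<^sub>n\<close> of \<open>K\<close> sum to zero, so on points of \<open>\<alpha> K + t\<close>, taking one point for
  each facet, the sum of the values is at most \<open>\<alpha> (n + 1)\<close> whatever \<open>t\<close> is. On the vertices of the
  polygon this sum is \<open>n + 1\<close>, so they do not fit for \<open>\<alpha> < 1\<close> (\<open>xi_corner_simplex_le\<close>).
\<close>

section \<open>A centre for points on a closed path\<close>

text \<open>
  The \<open>x i\<close> are positions on a circle of circumference \<open>L\<close>, listed in the direction of travel, and
  the \<open>if\<close> expression is the length of the directed arc from \<open>x i\<close> to \<open>x j\<close>. Weighting each point
  by the arc that precedes it makes the mean distance to all points equal; the bound then
  follows because the two arcs between distinct points add up to \<open>L\<close>, while the
  Cauchy--Schwarz inequality bounds the sum of the squared weights from below. Equally spaced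
  points give equality.
\<close>

lemma circular_weights:
  fixes x :: "nat \<Rightarrow> real"
  assumes mono: "\<And>i j. i \<le> j \<Longrightarrow> j \<le> k \<Longrightarrow> x i \<le> x j"
    and L: "x k - x 0 \<le> L" "0 < L"
  shows "\<exists>w :: nat \<Rightarrow> real. (\<forall>i\<le>k. 0 \<le> w i) \<and> (\<Sum>i\<le>k. w i) = 1 \<and>
           (\<forall>j\<le>k. (\<Sum>i\<le>k. w i * (if i \<le> j then x j - x i else L - (x i - x j)))
             \<le> L * real k / (2 * (real k + 1)))"
proof -
  define w where
    "w i = (case i of 0 \<Rightarrow> L - (x k - x 0) | Suc i' \<Rightarrow> x i - x i') / L" for i
  define d where "d i j = (if i \<le> j then x j - x i else L - (x i - x j))" for i j
  \<comment> \<open>The common value of the mean distances. It is the one for \<open>j = k\<close>, where no arc wraps around.\<close>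
  define F where "F = x k - (\<Sum>i\<le>k. w i * x i)"
  have w_nonneg: "0 \<le> w i" if "i \<le> k" for i
    using that L mono[of "i - 1" i] by (auto simp: w_def split: nat.split)
  have partial: "L * (\<Sum>i\<le>j. w i) = L - (x k - x j)" for j
  proof (induction j)
    case 0
    then show ?case using L by (simp add: w_def)
  next
    case (Suc j)
    have "L * w (Suc j) = x (Suc j) - x j" using L by (simp add: w_def)
    with Suc show ?case by (simp add: distrib_left)
  qed
  have total: "(\<Sum>i\<le>k. w i) = 1"
    using partial[of k] L by simp
  have const: "(\<Sum>i\<le>k. w i * d i j) = F" if "j \<le> k" for j
  proof -
    have "(\<Sum>i\<le>k. w i * d i j)
        = (\<Sum>i\<le>k. x j * w i - w i * x i + L * w i - (if i \<le> j then L * w i else 0))"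
      by (intro sum.cong) (auto simp: d_def algebra_simps)
    also have "\<dots> = x j * (\<Sum>i\<le>k. w i) - (\<Sum>i\<le>k. w i * x i) + L * (\<Sum>i\<le>k. w i)
        - (\<Sum>i\<le>k. if i \<le> j then L * w i else 0)"
      by (simp add: sum.distrib sum_subtractf sum_distrib_left)
    also have "(\<Sum>i\<le>k. if i \<le> j then L * w i else 0) = (\<Sum>i\<le>j. L * w i)"
      using that by (intro sum.mono_neutral_cong_right) auto
    also have "\<dots> = L - (x k - x j)"
      using partial[of j] by (simp add: sum_distrib_left)
    finally show ?thesis
      by (simp add: total F_def)
  qed
  \<comment> \<open>Averaging \<open>F\<close> over \<open>j\<close> with the same weights makes the double sum symmetric in \<open>i\<close> and \<open>j\<close>.\<close>
  have "2 * F = (\<Sum>j\<le>k. w j * F) + (\<Sum>j\<le>k. w j * F)"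
    by (simp add: total flip: sum_distrib_right)
  also have "(\<Sum>j\<le>k. w j * F) = (\<Sum>j\<le>k. \<Sum>i\<le>k. w j * w i * d i j)"
    by (intro sum.cong refl) (simp add: sum_distrib_left mult.assoc flip: const)
  also have "(\<Sum>j\<le>k. \<Sum>i\<le>k. w j * w i * d i j) + (\<Sum>j\<le>k. \<Sum>i\<le>k. w j * w i * d i j)
      = (\<Sum>j\<le>k. \<Sum>i\<le>k. w j * w i * d i j) + (\<Sum>j\<le>k. \<Sum>i\<le>k. w j * w i * d j i)"
    by (subst (2) sum.swap) (simp add: mult.commute mult.left_commute)
  also have "\<dots> = (\<Sum>j\<le>k. \<Sum>i\<le>k. w j * w i * (d i j + d j i))"
    by (simp add: sum.distrib distrib_left)
  also have "\<dots> = (\<Sum>j\<le>k. \<Sum>i\<le>k. L * w j * w i - (if i = j then L * (w j)\<^sup>2 else 0))"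
    by (intro sum.cong refl) (auto simp: d_def power2_eq_square algebra_simps)
  also have "\<dots> = (\<Sum>j\<le>k. L * w j - L * (w j)\<^sup>2)"
    by (intro sum.cong refl) (simp add: sum_subtractf total flip: sum_distrib_left)
  also have "\<dots> = L * (1 - (\<Sum>j\<le>k. (w j)\<^sup>2))"
    by (simp add: sum_subtractf right_diff_distrib total flip: sum_distrib_left)
  finally have F_eq: "2 * F = L * (1 - (\<Sum>j\<le>k. (w j)\<^sup>2))" .
  have "(\<Sum>j\<le>k. w j)\<^sup>2 \<le> (\<Sum>j\<le>k. (w j)\<^sup>2) * real (card {..k})"
    by (rule sum_squared_le_sum_of_squares)
  then have "1 / (real k + 1) \<le> (\<Sum>j\<le>k. (w j)\<^sup>2)"
    by (simp add: total field_simps)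
  then have "2 * F \<le> L * (1 - 1 / (real k + 1))"
    using L by (simp add: F_eq)
  also have "\<dots> = L * real k / (real k + 1)"
    by (simp add: field_simps)
  finally have "F \<le> L * real k / (2 * (real k + 1))"
    by (simp add: field_simps)
  then show ?thesis
    using w_nonneg total const unfolding d_def by (intro exI[of _ w]) simp
qed

text \<open>
  The functionals in \<open>T\<close> stand for an asymmetric norm, so the hypotheses bound
  the asymmetric distances between the \<open>q i\<close> by lengths of arcs. The centre is the convex
  combination with the weights just found.
\<close>

lemma cycle_center:
  fixes q :: "nat \<Rightarrow> 'v::real_normed_vector" and T :: "('v \<Rightarrow>\<^sub>L real) set"
  assumes mono: "\<And>i j. i \<le> j \<Longrightarrow> j \<le> k \<Longrightarrow> x i \<le> x j"
    and L: "x k - x 0 \<le> L" "0 < L"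
    and fwd: "\<And>p i j. p \<in> T \<Longrightarrow> i \<le> j \<Longrightarrow> j \<le> k \<Longrightarrow> p (q j - q i) \<le> x j - x i"
    and bwd: "\<And>p i j. p \<in> T \<Longrightarrow> j < i \<Longrightarrow> i \<le> k \<Longrightarrow> p (q j - q i) \<le> L - (x i - x j)"
  shows "\<exists>c. \<forall>p\<in>T. \<forall>j\<le>k. blinfun_apply p (q j - c) \<le> L * real k / (2 * (real k + 1))"
proof -
  obtain w :: "nat \<Rightarrow> real" where w: "\<And>i. i \<le> k \<Longrightarrow> 0 \<le> w i" "(\<Sum>i\<le>k. w i) = 1"
    and le: "\<And>j. j \<le> k \<Longrightarrow>
           (\<Sum>i\<le>k. w i * (if i \<le> j then x j - x i else L - (x i - x j)))
             \<le> L * real k / (2 * (real k + 1))"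
    using circular_weights[of k x L, OF mono L] by blast
  define c where "c = (\<Sum>i\<le>k. w i *\<^sub>R q i)"
  have "p (q j - c) \<le> L * real k / (2 * (real k + 1))" if "p \<in> T" "j \<le> k" for p j
  proof -
    have "q j - c = (\<Sum>i\<le>k. w i *\<^sub>R (q j - q i))"
      using w(2) by (simp add: c_def scaleR_diff_right sum_subtractf flip: scaleR_sum_left)
    then have "p (q j - c) = (\<Sum>i\<le>k. w i * p (q j - q i))"
      by (simp add: blinfun.sum_right blinfun.scaleR_right)
    also have "\<dots> \<le> (\<Sum>i\<le>k. w i * (if i \<le> j then x j - x i else L - (x i - x j)))"
      using w(1) fwd bwd that by (intro sum_mono mult_left_mono) auto
    also note le[OF \<open>j \<le> k\<close>]
    finally show ?thesis .
  qed
  then show ?thesis by blast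
qed

section \<open>Polar functionals and the gauge of a convex body\<close>

text \<open>
  The supremum in \<^const>\<open>asym_norm\<close> is one of real numbers and says nothing unless the values are
  bounded. They are, because \<open>K\<close> contains a ball around 0.
\<close>

lemma polar_le_asym_norm:
  assumes "0 \<in> interior K" and p: "p \<in> polar_body K"
  shows "blinfun_apply p v \<le> asym_norm (polar_body K) v"
proof -
  obtain e where e: "e > 0" "cball 0 e \<subseteq> K"
    using assms(1) by (meson mem_interior_cball)
  define y where "y = (e / (norm v + 1)) *\<^sub>R v"
  have "norm y \<le> e"
    using mult_left_mono[of "norm v / (norm v + 1)" 1 e] e(1)
    by (simp add: y_def divide_le_eq_1 add_nonneg_pos)
  then have y: "y \<in> K" using e by auto
  have "p' v \<le> (norm v + 1) / e" if "p' \<in> polar_body K" for p' :: "'a \<Rightarrow>\<^sub>L real"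
  proof -
    have "p' y \<le> 1" using that y by (auto simp: polar_body_def)
    moreover have "norm v + 1 > 0" by (smt (verit) norm_ge_zero)
    ultimately show ?thesis
      using e(1) by (simp add: y_def blinfun.scaleR_right field_simps)
  qed
  then have "bdd_above ((\<lambda>p. blinfun_apply p v) ` polar_body K)"
    by (auto intro!: bdd_aboveI)
  then show ?thesis
    unfolding asym_norm_def using p by (rule cSUP_upper2) simp
qed

text \<open>
  A point outside \<open>\<alpha> K\<close> is strictly separated from it. Since \<open>0 \<in> K\<close>, the separating hyperplane can
  be scaled to a functional in the polar that violates the bound.
\<close>

lemma bipolar:
  fixes K :: "'v::euclidean_space set"
  assumes "closed K" "convex K" "0 \<in> K" "0 < \<alpha>"
    and le: "\<And>p. p \<in> polar_body K \<Longrightarrow> blinfun_apply p v \<le> \<alpha>"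
  shows "v \<in> (*\<^sub>R) \<alpha> ` K"
proof (rule ccontr)
  assume "v \<notin> (*\<^sub>R) \<alpha> ` K"
  then have "(1 / \<alpha>) *\<^sub>R v \<notin> K"
    using \<open>0 < \<alpha>\<close> by (auto simp: image_iff dest!: bspec[where x = "(1 / \<alpha>) *\<^sub>R v"])
  then obtain a b where ab: "a \<bullet> ((1 / \<alpha>) *\<^sub>R v) < b" "\<And>y. y \<in> K \<Longrightarrow> b < a \<bullet> y"
    using separating_hyperplane_closed_point[OF assms(2,1)] by blast
  have b: "b < 0" using ab(2)[OF \<open>0 \<in> K\<close>] by simp
  define p where "p = (1 / b) *\<^sub>R blinfun_inner_right a"
  have p: "blinfun_apply p y = (a \<bullet> y) / b" for y
    by (simp add: p_def blinfun.scaleR_left)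
  have "p \<in> polar_body K"
    unfolding polar_body_def using ab(2) b by (auto simp: p field_simps intro: less_imp_le)
  from le[OF this] show False
    using ab(1) b \<open>0 < \<alpha>\<close> by (simp add: p field_simps)
qed

section \<open>The lower bound\<close>

text \<open>
  In dimension \<open>n\<close> the scaling factor \<open>L n / (2 (n + 1))\<close> serves all groups of at most \<open>n + 1\<close>
  vertices at once, so
  Helly's theorem applies to the convex sets of admissible translation vectors of the single
  vertices. Arcs are measured along the whole polygon, so passing to a group of vertices
  does not require a new polygon.
\<close>

lemma short_polygon_fits:
  fixes K :: "'v::euclidean_space set"
  assumes K: "convex_body K" "0 \<in> interior K" and "qs \<noteq> []"
    and short: "closed_length (polar_body K) qs < 2 + 2 / real DIM('v)"
  obtains \<alpha> t where "0 < \<alpha>" "\<alpha> < 1" "set qs \<subseteq> (\<lambda>x. \<alpha> *\<^sub>R x + t) ` K"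
proof -
  define T where "T = polar_body K"
  define m where "m = length qs"
  define N where "N = real DIM('v)"
  define l where "l i = asym_norm T (qs ! (Suc i mod m) - qs ! i)" for i
  define x where "x i = (\<Sum>k<i. l k)" for i
  \<comment> \<open>An upper bound for the length is all that is needed; taking it at least 1 keeps the weights
     and the scaling factor well defined when all vertices coincide.\<close>
  define L where "L = max 1 (closed_length T qs)"
  define \<alpha> where "\<alpha> = L * N / (2 * (N + 1))"
  have N: "N \<ge> 1" by (simp add: N_def Suc_leI)
  have m: "m > 0" using \<open>qs \<noteq> []\<close> by (simp add: m_def)
  have L: "0 < L" "x m \<le> L" by (auto simp: L_def closed_length_def x_def l_def m_def)
  have "L < 2 + 2 / N" using short N by (auto simp: L_def T_def N_def intro: add_pos_pos)
  then have \<alpha>: "0 < \<alpha>" "\<alpha> < 1" using L N by (auto simp: \<alpha>_def field_simps)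
  have edge: "p (qs ! (Suc i mod m) - qs ! i) \<le> l i" if "p \<in> T" for p i
    unfolding l_def using polar_le_asym_norm[OF K(2)] that by (simp add: T_def)
  have "0 \<in> T" by (simp add: T_def polar_body_def)
  from edge[OF this] have l_nonneg: "0 \<le> l i" for i by simp
  have x_mono: "x i \<le> x j" if "i \<le> j" for i j
    unfolding x_def using that l_nonneg by (intro sum_mono2) auto
  have fwd: "p (qs ! j - qs ! i) \<le> x j - x i" if "p \<in> T" "i \<le> j" "j < m" for p i j
    using \<open>i \<le> j\<close> \<open>j < m\<close>
  proof (induction j rule: dec_induct)
    case (step j)
    have "p (qs ! Suc j - qs ! i) = p (qs ! j - qs ! i) + p (qs ! (Suc j mod m) - qs ! j)"
      using step.prems by (simp flip: blinfun.add_right)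
    also have "\<dots> \<le> (x j - x i) + l j"
      using step by (intro add_mono edge[OF \<open>p \<in> T\<close>]) auto
    finally show ?case by (simp add: x_def)
  qed simp
  have bwd: "p (qs ! j - qs ! i) \<le> L - (x i - x j)" if "p \<in> T" "j < i" "i < m" for p i j
  proof -
    obtain m' where m': "m = Suc m'" using m gr0_implies_Suc by blast
    have "p (qs ! j - qs ! i)
        = p (qs ! j - qs ! 0) + p (qs ! (Suc m' mod m) - qs ! m') + p (qs ! m' - qs ! i)"
      by (simp add: m' flip: blinfun.add_right)
    also have "\<dots> \<le> (x j - x 0) + l m' + (x m' - x i)"
      using that m' by (intro add_mono fwd edge) auto
    also have "\<dots> = x m - (x i - x j)" by (simp add: x_def m')
    finally show ?thesis using L by simp
  qed
  \<comment> \<open>The translation vectors \<open>t\<close> with \<open>qs ! i\<close> in \<open>\<alpha> K + t\<close>.\<close>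
  define f where "f i = {t. \<forall>p\<in>T. p (qs ! i - t) \<le> \<alpha>}" for i
  have small: "(\<Inter>i\<in>I. f i) \<noteq> {}" if I: "I \<subseteq> {..<m}" "I \<noteq> {}" "card I \<le> DIM('v) + 1" for I
  proof -
    have fin: "finite I" using I(1) finite_subset by blast
    obtain k where k: "card I = Suc k"
      using I(2) fin by (metis card_eq_0_iff not0_implies_Suc)
    obtain r where r: "strict_mono_on {..<card I} r" "\<forall>n<card I. r n \<in> I"
      using finite_enumerate[OF fin] by blast
    have "card (r ` {..<card I}) = card I"
      using strict_mono_on_imp_inj_on[OF r(1)] by (simp add: card_image)
    then have I_eq: "r ` {..<card I} = I"
      using r(2) fin by (intro card_subset_eq) auto
    have r_less: "r i < r j" if "i < j" "j \<le> k" for i j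
      using strict_mono_onD[OF r(1)] that k by auto
    then have r_le: "r i \<le> r j" if "i \<le> j" "j \<le> k" for i j
      using that by (metis le_less)
    have r_m: "r i < m" if "i \<le> k" for i
    proof -
      have "r i \<in> I" using r(2) k that by simp
      then show ?thesis using I(1) by blast
    qed
    have "\<exists>c. \<forall>p\<in>T. \<forall>j\<le>k. p (qs ! r j - c) \<le> L * real k / (2 * (real k + 1))"
    proof (rule cycle_center[where x = "\<lambda>i. x (r i)"])
      show "x (r k) - x (r 0) \<le> L"
        using x_mono[of "r k" m] x_mono[of 0 "r 0"] r_m[of k] L by (simp add: x_def)
    qed (use x_mono r_le r_less r_m L(1) fwd bwd in auto)
    then obtain c where c: "\<And>p j. p \<in> T \<Longrightarrow> j \<le> k \<Longrightarrow>
        p (qs ! r j - c) \<le> L * real k / (2 * (real k + 1))"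
      by blast
    have "real k \<le> N" using I(3) k by (simp add: N_def)
    then have "real k / (real k + 1) \<le> N / (N + 1)" by (simp add: field_simps)
    then have "L / 2 * (real k / (real k + 1)) \<le> L / 2 * (N / (N + 1))"
      using L(1) by (intro mult_left_mono) auto
    then have k_le: "L * real k / (2 * (real k + 1)) \<le> \<alpha>" by (simp add: \<alpha>_def)
    have "c \<in> f i" if "i \<in> I" for i
    proof -
      from that obtain j where "i = r j" "j \<le> k" using I_eq k by auto
      then show ?thesis unfolding f_def using c k_le by force
    qed
    then show ?thesis by blast
  qed
  have conv: "convex (f i)" for i
  proof -
    have "f i = (\<Inter>p\<in>T. blinfun_apply p -` {p (qs ! i) - \<alpha>..})"
      by (auto simp: f_def blinfun.diff_right)
    moreover have "convex (blinfun_apply p -` {p (qs ! i) - \<alpha>..})" for p :: "'v \<Rightarrow>\<^sub>L real"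
      by (intro convex_linear_vimage blinfun.bounded_linear_right bounded_linear.linear) simp
    ultimately show ?thesis by (auto intro: convex_INT)
  qed
  have sub: "\<Inter>G \<noteq> {}" if G: "G \<subseteq> f ` {..<m}" "G \<noteq> {}" "card G \<le> DIM('v) + 1" for G
  proof -
    obtain I where I: "I \<subseteq> {..<m}" "inj_on f I" "G = f ` I"
      using G(1) by (meson subset_image_inj)
    then show ?thesis using small[of I] G by (auto simp: card_image)
  qed
  \<comment> \<open>Helly's theorem presupposes more than \<open>n\<close> distinct sets; fewer are covered by \<open>sub\<close> itself.\<close>
  have "\<Inter>(f ` {..<m}) \<noteq> {}"
  proof (cases "card (f ` {..<m}) \<ge> DIM('v) + 1")
    case True
    show ?thesis
    proof (rule Helly[OF True])
      show "\<forall>s\<in>f ` {..<m}. convex s" using conv by blast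
      show "\<Inter>G \<noteq> {}" if "G \<subseteq> f ` {..<m}" "card G = DIM('v) + 1" for G
        using that by (intro sub) auto
    qed
  next
    case False
    then show ?thesis using m by (intro sub) auto
  qed
  then obtain t where t: "\<And>i. i < m \<Longrightarrow> t \<in> f i" by blast
  have "q \<in> (\<lambda>x. \<alpha> *\<^sub>R x + t) ` K" if "q \<in> set qs" for q
  proof -
    from that obtain i where i: "i < m" "q = qs ! i" by (auto simp: in_set_conv_nth m_def)
    have "q - t \<in> (*\<^sub>R) \<alpha> ` K"
    proof (rule bipolar)
      show "closed K" "convex K" "0 \<in> K"
        using K interior_subset by (auto simp: convex_body_def compact_imp_closed)
    qed (use t[OF i(1)] i(2) \<alpha>(1) in \<open>auto simp: f_def T_def\<close>)
    then show ?thesis by (auto simp: image_iff algebra_simps)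
  qed
  then show ?thesis using that \<alpha> by blast
qed

lemma xi_polar_body_ge:
  fixes K :: "'v::euclidean_space set"
  assumes "convex_body K" "0 \<in> interior K"
  shows "xi (polar_body K) K \<ge> ereal (2 + 2 / real DIM('v))"
  unfolding xi_def
proof (intro INF_greatest)
  fix m :: nat and qs
  assume "m \<in> {1..}" and qs: "qs \<in> nonfitting_tuples m K"
  then have "qs \<noteq> []" by (auto simp: nonfitting_tuples_def)
  then have "\<not> closed_length (polar_body K) qs < 2 + 2 / real DIM('v)"
    using short_polygon_fits[OF assms \<open>qs \<noteq> []\<close>] qs
    unfolding nonfitting_tuples_def by blast
  then show "ereal (2 + 2 / real DIM('v)) \<le> ereal (closed_length (polar_body K) qs)"
    by simp
qed

section \<open>A simplex attaining the bound\<close>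

text \<open>
  The simplex with centroid 0 whose facet functionals are the \<open>n\<close> coordinates and the
  negative of their sum. Its vertices are the all-ones vector \<open>1\<close> and the vectors \<open>1 - (n + 1) e\<^sub>i\<close>.
\<close>

definition corner_simplex :: "(real ^ 'n) set" where
  "corner_simplex = {x. (\<forall>i. x $ i \<le> 1) \<and> - (\<Sum>i\<in>UNIV. x $ i) \<le> 1}"

lemma zero_in_interior_corner_simplex: "0 \<in> interior (corner_simplex :: (real ^ 'n) set)"
proof (rule interiorI)
  let ?U = "(\<Inter>i. {x :: real ^ 'n. x $ i < 1}) \<inter> {x. - (\<Sum>i\<in>UNIV. x $ i) < 1}"
  show "open ?U"
    by (intro open_Int open_INT open_Collect_less continuous_intros ballI) auto
  show "?U \<subseteq> corner_simplex" by (auto simp: corner_simplex_def less_imp_le)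
qed simp

lemma convex_body_corner_simplex: "convex_body (corner_simplex :: (real ^ 'n) set)"
proof -
  let ?n = "real CARD('n)"
  have eq: "corner_simplex = (\<Inter>i. {x :: real ^ 'n. x $ i \<le> 1}) \<inter> {x. - (\<Sum>i\<in>UNIV. x $ i) \<le> 1}"
    by (auto simp: corner_simplex_def)
  have "closed (corner_simplex :: (real ^ 'n) set)"
    unfolding eq by (intro closed_Int closed_INT closed_Collect_le continuous_intros ballI)
  moreover have "(corner_simplex :: (real ^ 'n) set) \<subseteq> cbox (\<chi> i. - ?n) (\<chi> i. 1)"
  proof
    fix x :: "real ^ 'n" assume x: "x \<in> corner_simplex"
    \<comment> \<open>The last facet bounds the sum from below, and the other coordinates are at most 1.\<close>
    have "- ?n \<le> x $ i" for i
    proof -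
      have "- 1 \<le> x $ i + (\<Sum>j\<in>UNIV - {i}. x $ j)"
        using x by (simp add: corner_simplex_def sum.remove[of UNIV i])
      moreover have "(\<Sum>j\<in>UNIV - {i}. x $ j) \<le> (\<Sum>j\<in>UNIV - {i}. 1)"
        using x by (intro sum_mono) (auto simp: corner_simplex_def)
      moreover have "(\<Sum>j\<in>UNIV - {i}. 1) = ?n - 1" by (simp add: of_nat_diff Suc_leI)
      ultimately show ?thesis by linarith
    qed
    then show "x \<in> cbox (\<chi> i. - ?n) (\<chi> i. 1)"
      using x by (simp add: mem_box_cart corner_simplex_def)
  qed
  then have "bounded (corner_simplex :: (real ^ 'n) set)"
    using bounded_cbox bounded_subset by blast
  moreover have "convex (corner_simplex :: (real ^ 'n) set)"
  proof (rule convexI)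
    fix x y :: "real ^ 'n" and u v :: real
    assume *: "x \<in> corner_simplex" "y \<in> corner_simplex" "0 \<le> u" "0 \<le> v" "u + v = 1"
    have comb: "u * a + v * b \<le> 1" if "a \<le> 1" "b \<le> 1" for a b
      using convex_bound_le[of a 1 b u v] that * by simp
    have "- (\<Sum>i\<in>UNIV. (u *\<^sub>R x + v *\<^sub>R y) $ i)
        = u * - (\<Sum>i\<in>UNIV. x $ i) + v * - (\<Sum>i\<in>UNIV. y $ i)"
      by (simp add: sum.distrib sum_distrib_left)
    also have "\<dots> \<le> 1" using * by (intro comb) (auto simp: corner_simplex_def)
    finally show "u *\<^sub>R x + v *\<^sub>R y \<in> corner_simplex"
      using * comb by (auto simp: corner_simplex_def)
  qed
  ultimately show ?thesis
    using zero_in_interior_corner_simplex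
    by (auto simp: convex_body_def compact_eq_bounded_closed)
qed

text \<open>
  The polygon adds the vertices of the simplex, scaled by \<open>2/n\<close>, one after the other. A facet
  functional grows by \<open>2/n\<close> along every edge except the one pointing to the opposite vertex, so it
  is largest just before that edge. These are the values that are summed.
\<close>

lemma xi_corner_simplex_le:
  "xi (polar_body corner_simplex) (corner_simplex :: (real ^ 'n) set)
     \<le> ereal (2 + 2 / real CARD('n))"
proof -
  let ?K = "corner_simplex :: (real ^ 'n) set"
  define n where "n = CARD('n)"
  have n: "n > 0" by (simp add: n_def)
  obtain e :: "'n \<Rightarrow> nat" where e: "bij_betw e UNIV {..<n}"
    using ex_bij_betw_finite_nat[of "UNIV :: 'n set"] by (auto simp: n_def atLeast0LessThan)
  have e_less: "e a < n" for a using e by (auto simp: bij_betw_def)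
  \<comment> \<open>\<open>q j = (2/n) (v\<^sub>0 + \<dots> + v\<^bsub>j-1\<^esub>)\<close> with \<open>v\<^bsub>e a\<^esub> = 1 - (n + 1) e\<^sub>a\<close>; the edge from \<open>q n\<close> back to
     \<open>q 0 = 0\<close> is \<open>(2/n) 1\<close>.\<close>
  define q :: "nat \<Rightarrow> real ^ 'n" where
    "q j = (\<chi> a. 2 / real n * (real j - (if e a < j then real n + 1 else 0)))" for j
  define qs where "qs = map q [0..<n + 1]"
  have edge: "(real n / 2) *\<^sub>R (q (Suc j mod (n + 1)) - q j) \<in> ?K" if "j \<le> n" for j
  proof (cases "j = n")
    case True
    then have eq: "(real n / 2) *\<^sub>R (q (Suc j mod (n + 1)) - q j) = (\<chi> a. 1)"
      using n e_less by (simp add: q_def vec_eq_iff field_simps)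
    show ?thesis unfolding eq by (simp add: corner_simplex_def)
  next
    case False
    then have j: "j < n" using that by simp
    then obtain b where b: "e b = j" using e by (metis bij_betw_iff_bijections lessThan_iff)
    have e_eq: "e a = j \<longleftrightarrow> a = b" for a
      using e b by (auto simp: bij_betw_def inj_on_def)
    have eq: "(real n / 2) *\<^sub>R (q (Suc j mod (n + 1)) - q j)
        = (\<chi> a. 1 - (if a = b then real n + 1 else 0))"
    proof -
      have "real n / 2 * (q (Suc j) $ a - q j $ a) = 1 - (if e a = j then real n + 1 else 0)" for a
        using n by (auto simp: q_def field_simps less_Suc_eq)
      then show ?thesis using j by (simp add: vec_eq_iff e_eq)
    qed
    show ?thesis unfolding eq
      by (simp add: corner_simplex_def sum_subtractf flip: n_def)
  qed
  have len: "closed_length (polar_body ?K) qs \<le> 2 + 2 / real n"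
  proof -
    have "asym_norm (polar_body ?K) (qs ! (Suc j mod length qs) - qs ! j) \<le> 2 / real n"
      if "j < n + 1" for j
    proof -
      have "qs ! (Suc j mod length qs) - qs ! j = q (Suc j mod (n + 1)) - q j"
        using that unfolding qs_def by (simp del: upt_Suc)
      moreover have "p (q (Suc j mod (n + 1)) - q j) \<le> 2 / real n" if "p \<in> polar_body ?K" for p
      proof -
        have "p ((real n / 2) *\<^sub>R (q (Suc j mod (n + 1)) - q j)) \<le> 1"
          using that edge[of j] \<open>j < n + 1\<close> by (auto simp: polar_body_def)
        then have "real n / 2 * p (q (Suc j mod (n + 1)) - q j) \<le> 1"
          unfolding blinfun.scaleR_right by simp
        then show ?thesis using n by (simp add: field_simps)
      qed
      moreover have "0 \<in> polar_body ?K" by (simp add: polar_body_def)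
      ultimately show ?thesis
        unfolding asym_norm_def by (auto intro!: cSUP_least)
    qed
    then have "closed_length (polar_body ?K) qs \<le> (\<Sum>j<length qs. 2 / real n)"
      unfolding closed_length_def by (intro sum_mono) (simp add: qs_def)
    also have "\<dots> = 2 + 2 / real n" using n by (simp add: qs_def field_simps)
    finally show ?thesis .
  qed
  have "\<not> set qs \<subseteq> (\<lambda>x. \<alpha> *\<^sub>R x + t) ` ?K" if \<alpha>: "0 < \<alpha>" "\<alpha> < 1" for \<alpha> t
  proof
    assume fits: "set qs \<subseteq> (\<lambda>x. \<alpha> *\<^sub>R x + t) ` ?K"
    have "\<exists>y. y \<in> ?K \<and> q j = \<alpha> *\<^sub>R y + t" if "j \<le> n" for j
    proof -
      have "q j \<in> set qs" using that by (auto simp: qs_def simp del: upt_Suc)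
      then show ?thesis using fits by blast
    qed
    then obtain y where y: "\<And>j. j \<le> n \<Longrightarrow> y j \<in> ?K" "\<And>j. j \<le> n \<Longrightarrow> q j = \<alpha> *\<^sub>R y j + t"
      by metis
    have "(\<Sum>a\<in>UNIV. q (e a) $ a) = (\<Sum>a\<in>UNIV. 2 / real n * real (e a))"
      by (simp add: q_def)
    also have "\<dots> = (\<Sum>i<n. 2 / real n * real i)"
      by (rule sum.reindex_bij_betw[OF e])
    also have "\<dots> = 2 / real n * (\<Sum>i<n. real i)"
      by (simp add: sum_distrib_left)
    also have "(\<Sum>i<n. real i) = real n * (real n - 1) / 2"
      by (induction n) (auto simp: field_simps)
    also have "2 / real n * \<dots> = real n - 1" using n by simp
    finally have 1: "(\<Sum>a\<in>UNIV. q (e a) $ a) = real n - 1" .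
    have 2: "(\<Sum>a\<in>UNIV. q n $ a) = - 2"
      using n e_less by (simp add: q_def n_def[symmetric])
    \<comment> \<open>The coordinate \<open>a\<close> is evaluated at \<open>q (e a)\<close> and the remaining facet functional at \<open>q n\<close>; the
       contributions of \<open>t\<close> cancel.\<close>
    have "real n + 1 = (\<Sum>a\<in>UNIV. q (e a) $ a) - (\<Sum>a\<in>UNIV. q n $ a)"
      using 1 2 by simp
    also have "\<dots> = (\<Sum>a\<in>UNIV. \<alpha> * y (e a) $ a + t $ a) - (\<Sum>a\<in>UNIV. \<alpha> * y n $ a + t $ a)"
      using y(2) e_less by (simp add: less_imp_le)
    also have "\<dots> = \<alpha> * ((\<Sum>a\<in>UNIV. y (e a) $ a) - (\<Sum>a\<in>UNIV. y n $ a))"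
      by (simp add: sum.distrib right_diff_distrib sum_distrib_left)
    also have "\<dots> \<le> \<alpha> * (real n + 1)"
    proof (rule mult_left_mono)
      have "(\<Sum>a\<in>UNIV. y (e a) $ a) \<le> (\<Sum>a\<in>(UNIV :: 'n set). 1)"
        using y(1) e_less by (intro sum_mono) (auto simp: corner_simplex_def less_imp_le)
      moreover have "- (\<Sum>a\<in>UNIV. y n $ a) \<le> 1"
        using y(1)[of n] by (simp add: corner_simplex_def)
      ultimately show "(\<Sum>a\<in>UNIV. y (e a) $ a) - (\<Sum>a\<in>UNIV. y n $ a) \<le> real n + 1"
        by (simp add: n_def)
    qed (use \<alpha> in simp)
    also have "\<dots> < 1 * (real n + 1)"
      using \<alpha> by (intro mult_strict_right_mono) auto
    finally show False by simp
  qed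
  then have "qs \<in> nonfitting_tuples (n + 1) ?K"
    by (auto simp: nonfitting_tuples_def qs_def)
  then have "xi (polar_body ?K) ?K \<le> ereal (closed_length (polar_body ?K) qs)"
    unfolding xi_def by (intro INF_lower2[of "n + 1"] INF_lower) auto
  also have "\<dots> \<le> ereal (2 + 2 / real CARD('n))"
    using len by (simp add: n_def)
  finally show ?thesis .
qed

theorem theorem4p1:
  shows "(\<forall>K :: (real ^ 'n) set. convex_body K \<and> 0 \<in> interior K \<longrightarrow>
            xi (polar_body K) K \<ge> ereal (2 + 2 / real CARD('n))) \<and>
         (\<exists>K :: (real ^ 'n) set. convex_body K \<and> 0 \<in> interior K \<and>
            xi (polar_body K) K = ereal (2 + 2 / real CARD('n)))"
proof (intro conjI allI impI)
  show lower: "ereal (2 + 2 / real CARD('n)) \<le> xi (polar_body K) K"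
    if "convex_body K \<and> 0 \<in> interior K" for K :: "(real ^ 'n) set"
    using xi_polar_body_ge[of K] that by simp
  show "\<exists>K :: (real ^ 'n) set. convex_body K \<and> 0 \<in> interior K \<and>
      xi (polar_body K) K = ereal (2 + 2 / real CARD('n))"
    using lower[of corner_simplex] xi_corner_simplex_le convex_body_corner_simplex
      zero_in_interior_corner_simplex by (intro exI[of _ corner_simplex]) (auto intro: antisym)
qed

end
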